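(* Let $\mathbb{B}^n$ be the unit ball in $\mathbb{C}^n$, write $z=(z',z'')$ with $z'=(z_1,\ldots,z_k)$ and $z''=(z_{k+1},\ldots,z_n)$, and let $V=\{z\in\mathbb{B}^n: z'=0\}$. Let $\varphi$ be a plurisubharmonic function on $\mathbb{B}^n$ that is radial with respect to $V$, i.e. $\varphi(z)=\varphi(|z'|)$ depends only on $|z'|$. Then for every holomorphic function $f$ on $V$, the $L^2$-minimum extension of $f$ to $\mathbb{B}^n$ with respect to $\varphi$ is the function $F(z)=f(0,z'')$.
   Context: The $L^2$-minimum extension of $f$ with respect to $\varphi$ is the holomorphic function on $\mathbb{B}^n$ restricting to $f$ on $V$ that minimizes $\int_{\mathbb{B}^n}|F|^2e^{-\varphi}$ (Lebesgue measure) among all holomorphic functions $F$ on $\mathbb{B}^n$ with $F|_V=f$. *)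

theory Defs
  imports "HOL-Analysis.Analysis"
begin

(* The coordinates z_1, ..., z_n of a vector in complex^'n are numbered along the linear order
   of 'n: the 1-based position of the index i is card {..i}. *)
definition first_coords :: "nat \<Rightarrow> 'n::{finite,linorder} set" where
  "first_coords k = {i. card {..i} \<le> k}"

(* (z', 0) and (0, z'') as vectors of the whole space; in particular norm (head_part k z) = |z'|. *)
definition head_part :: "nat \<Rightarrow> complex^'n::{finite,linorder} \<Rightarrow> complex^'n::_" where
  "head_part k z = (\<chi> i. if i \<in> first_coords k then z $ i else 0)"

definition tail_part :: "nat \<Rightarrow> complex^'n::{finite,linorder} \<Rightarrow> complex^'n::_" where
  "tail_part k z = (\<chi> i. if i \<in> first_coords k then 0 else z $ i)"

abbreviation unit_ball :: "(complex^'n::finite) set" where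
  "unit_ball \<equiv> ball 0 1"

definition linear_slice :: "nat \<Rightarrow> (complex^'n::{finite,linorder}) set" where
  "linear_slice k = {z \<in> unit_ball. head_part k z = 0}"

(* Differentiability within S with a complex-linear derivative, as in holomorphic_on.  On an open
   set this is holomorphy in several variables.  On an open piece S of a complex linear subspace it
   is holomorphy on the complex manifold S: only the values of f on S matter, and the values of the
   derivative transversally to S are irrelevant. *)
definition sev_holomorphic_on :: "(complex^'n::finite \<Rightarrow> complex) \<Rightarrow> (complex^'n) set \<Rightarrow> bool" where
  "sev_holomorphic_on f S \<longleftrightarrow>
     (\<forall>z\<in>S. \<exists>D. Vector_Spaces.linear (*s) (*) D \<and> (f has_derivative D) (at z within S))"

(* Integral of an extended real function as (integral of the positive part) - (integral of the
   negative part); e2ennreal truncates negative values to 0.  It is only used for functions that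
   are bounded above on a space of finite measure, so that infinity - infinity does not occur. *)
definition ereal_integral :: "'a measure \<Rightarrow> ('a \<Rightarrow> ereal) \<Rightarrow> ereal" where
  "ereal_integral M u =
     enn2ereal (\<integral>\<^sup>+x. e2ennreal (u x) \<partial>M) - enn2ereal (\<integral>\<^sup>+x. e2ennreal (- u x) \<partial>M)"

(* Upper semicontinuous with values in [-infinity, infinity), and satisfying the sub-mean value
   inequality on every closed disc contained in a complex line and in S.  The function that is
   constantly -infinity is admitted. *)
definition plurisubharmonic_on :: "(complex^'n::finite \<Rightarrow> ereal) \<Rightarrow> (complex^'n) set \<Rightarrow> bool" where
  "plurisubharmonic_on \<phi> S \<longleftrightarrow>
     open S \<and>
     (\<forall>z\<in>S. \<phi> z < \<infinity>) \<and>
     (\<forall>a. openin (top_of_set S) {z \<in> S. \<phi> z < a}) \<and>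
     (\<forall>z w. (\<forall>\<zeta>. cmod \<zeta> \<le> 1 \<longrightarrow> z + \<zeta> *s w \<in> S) \<longrightarrow>
        \<phi> z \<le> ereal (1 / (2 * pi)) *
               ereal_integral (restrict_space lborel {0..2 * pi}) (\<lambda>\<theta>. \<phi> (z + cis \<theta> *s w)))"

definition radial_wrt_slice :: "nat \<Rightarrow> (complex^'n::{finite,linorder} \<Rightarrow> ereal) \<Rightarrow> bool" where
  "radial_wrt_slice k \<phi> \<longleftrightarrow>
     (\<exists>\<psi>::real \<Rightarrow> ereal. \<forall>z\<in>unit_ball. \<phi> z = \<psi> (norm (head_part k z)))"

definition exp_uminus :: "ereal \<Rightarrow> ennreal" where
  "exp_uminus x = (case x of ereal r \<Rightarrow> ennreal (exp (- r)) | PInfty \<Rightarrow> 0 | MInfty \<Rightarrow> \<infinity>)"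

definition weighted_sq_norm :: "(complex^'n::finite \<Rightarrow> ereal) \<Rightarrow> (complex^'n \<Rightarrow> complex) \<Rightarrow> ennreal" where
  "weighted_sq_norm \<phi> F =
     (\<integral>\<^sup>+z\<in>unit_ball. ennreal ((cmod (F z))\<^sup>2) * exp_uminus (\<phi> z) \<partial>lborel)"

definition holomorphic_extension ::
    "nat \<Rightarrow> (complex^'n::{finite,linorder} \<Rightarrow> complex) \<Rightarrow> (complex^'n::_ \<Rightarrow> complex) \<Rightarrow> bool" where
  "holomorphic_extension k f F \<longleftrightarrow>
     sev_holomorphic_on F unit_ball \<and> (\<forall>z\<in>linear_slice k. F z = f z)"

definition L2_minimum_extension ::
    "nat \<Rightarrow> (complex^'n::{finite,linorder} \<Rightarrow> ereal) \<Rightarrow> (complex^'n::_ \<Rightarrow> complex) \<Rightarrow>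
     (complex^'n::_ \<Rightarrow> complex) \<Rightarrow> bool" where
  "L2_minimum_extension k \<phi> f F \<longleftrightarrow>
     holomorphic_extension k f F \<and>
     (\<forall>G. holomorphic_extension k f G \<longrightarrow> weighted_sq_norm \<phi> F \<le> weighted_sq_norm \<phi> G)"

end

theory Submission
  imports Defs "HOL-Complex_Analysis.Cauchy_Integral_Formula"
begin

text \<open>Let \<open>G\<close> be holomorphic on the ball, \<open>F z = G (0, z'')\<close> and \<open>H = G - F\<close>.  Along each circle
  \<open>t \<mapsto> (e\<^sup>i\<^sup>t z', z'')\<close> the function \<open>F\<close> is constant, while \<open>H\<close> has mean \<open>0\<close>: it is
  holomorphic on the disc \<open>\<zeta> \<mapsto> (\<zeta> z', z'')\<close> and vanishes at the centre.  So \<open>F\<close> and \<open>H\<close> are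
  orthogonal on the circle (\<open>circle_Pythagoras\<close>).

  The weight \<open>exp (-\<phi>)\<close>, the ball and Lebesgue measure are all invariant under the rotations of
  \<open>z'\<close>, so a weighted norm does not change when the square of the function is first averaged over
  these circles (\<open>rotation_average\<close>).  Hence \<open>\<parallel>G\<parallel>\<^sup>2 = \<parallel>F\<parallel>\<^sup>2 + \<parallel>H\<parallel>\<^sup>2\<close>
  (\<open>weighted_sq_norm_Pythagoras\<close>), an identity in \<open>[0, \<infinity>]\<close>: the orthogonality is used on
  each circle separately, where \<open>G\<close> is continuous, and only nonnegative functions are integrated
  over the ball.

  If \<open>G\<close> extends \<open>f\<close>, then \<open>F\<close> is the function \<open>f (0, z'')\<close>, which is therefore minimal.  A minimal
  \<open>G\<close> of finite norm has \<open>\<parallel>H\<parallel> = 0\<close>; the weight is positive because \<open>\<phi> < \<infinity>\<close>, so the continuous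
  function \<open>H\<close> vanishes on the ball.  The weight is measurable because \<open>\<phi>\<close> is upper semicontinuous.\<close>

section \<open>Lebesgue measure under linear isometries\<close>

lemma nn_integral_lborel_shift:
  fixes f :: "'a::euclidean_space \<Rightarrow> ennreal"
  assumes [measurable]: "f \<in> borel_measurable borel"
  shows "(\<integral>\<^sup>+x. f (c + x) \<partial>lborel) = (\<integral>\<^sup>+x. f x \<partial>lborel)"
proof -
  have "(\<integral>\<^sup>+x. f x \<partial>lborel) = (\<integral>\<^sup>+x. f x \<partial>distr lborel borel ((+) c))"
    by (simp add: lborel_distr_plus)
  also have "\<dots> = (\<integral>\<^sup>+x. f (c + x) \<partial>lborel)"
    by (simp add: nn_integral_distr)
  finally show ?thesis by simp
qed

text \<open>The usual uniqueness argument for Haar measure: with \<open>g\<close> the indicator of the unit ball,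
  \<open>\<integral>\<integral> f (T x) g (y - T x) dx dy\<close> is evaluated in both orders, using translation invariance only.
  Integrating over \<open>y\<close> first gives \<open>(\<integral> f \<circ> T) (\<integral> g)\<close>; substituting \<open>x \<mapsto> T\<^sup>-\<^sup>1 y + x\<close> first gives
  \<open>\<integral>\<integral> f (y + T x) g (- T x) dx dy = (\<integral> f) (\<integral> g)\<close>, because \<open>T\<close> and the reflection preserve the
  ball.\<close>
lemma nn_integral_lborel_linear_isometry:
  fixes T :: "'a::euclidean_space \<Rightarrow> 'a" and f :: "'a \<Rightarrow> ennreal"
  assumes T: "linear T" and norm_T: "\<And>x. norm (T x) = norm x"
    and f [measurable]: "f \<in> borel_measurable borel"
  shows "(\<integral>\<^sup>+x. f (T x) \<partial>lborel) = (\<integral>\<^sup>+x. f x \<partial>lborel)"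
proof -
  define g :: "'a \<Rightarrow> ennreal" where "g = indicator (ball 0 1)"
  have g [measurable]: "g \<in> borel_measurable borel" unfolding g_def
    by (intro borel_measurable_indicator) simp
  have T_meas [measurable]: "T \<in> borel_measurable borel"
    using T by (intro borel_measurable_continuous_onI linear_continuous_on linear_conv_bounded_linear[THEN iffD1])
  have "inj T"
    using norm_T by (metis linear_injective_0[OF T] norm_eq_zero)
  then have "surj T"
    using linear_injective_imp_surjective[OF T] by blast
  have g_iso: "g (- T x) = g x" for x
    by (simp add: g_def indicator_def norm_T)
  let ?I = "\<integral>\<^sup>+x. g x \<partial>lborel"
  have "(\<integral>\<^sup>+x. f (T x) \<partial>lborel) * ?I = (\<integral>\<^sup>+x. f (T x) * (\<integral>\<^sup>+y. g (- T x + y) \<partial>lborel) \<partial>lborel)"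
    using nn_integral_lborel_shift[OF g] by (simp only:) (simp add: nn_integral_multc)
  also have "\<dots> = (\<integral>\<^sup>+x. (\<integral>\<^sup>+y. f (T x) * g (- T x + y) \<partial>lborel) \<partial>lborel)"
    by (simp add: nn_integral_cmult)
  also have "\<dots> = (\<integral>\<^sup>+y. (\<integral>\<^sup>+x. f (T x) * g (- T x + y) \<partial>lborel) \<partial>lborel)"
    by (rule lborel_pair.Fubini'[symmetric]) measurable
  also have "\<dots> = (\<integral>\<^sup>+y. (\<integral>\<^sup>+x. f (y + T x) * g x \<partial>lborel) \<partial>lborel)"
  proof (rule nn_integral_cong)
    fix y :: 'a
    obtain u where u: "y = T u" using \<open>surj T\<close> by blast
    have "(\<integral>\<^sup>+x. f (T x) * g (- T x + y) \<partial>lborel)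
        = (\<integral>\<^sup>+x. f (T (u + x)) * g (- T (u + x) + y) \<partial>lborel)"
      by (subst nn_integral_lborel_shift) simp_all
    also have "\<dots> = (\<integral>\<^sup>+x. f (y + T x) * g x \<partial>lborel)"
      by (simp add: u linear_add[OF T] g_iso)
    finally show "(\<integral>\<^sup>+x. f (T x) * g (- T x + y) \<partial>lborel) = (\<integral>\<^sup>+x. f (y + T x) * g x \<partial>lborel)" .
  qed
  also have "\<dots> = (\<integral>\<^sup>+x. (\<integral>\<^sup>+y. f (T x + y) * g x \<partial>lborel) \<partial>lborel)"
    by (subst lborel_pair.Fubini') (simp_all add: add.commute)
  also have "\<dots> = (\<integral>\<^sup>+x. f x \<partial>lborel) * ?I"
    by (simp add: nn_integral_multc nn_integral_lborel_shift nn_integral_cmult)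
  finally have eq: "(\<integral>\<^sup>+x. f (T x) \<partial>lborel) * ?I = (\<integral>\<^sup>+x. f x \<partial>lborel) * ?I" .
  have I: "?I = emeasure lborel (ball (0::'a) 1)"
    by (simp add: g_def)
  have "?I \<noteq> \<infinity>"
    using emeasure_lborel_ball_finite[of "0::'a" 1] by (simp add: I)
  moreover have "?I \<noteq> 0"
    using content_ball_pos[of 1 "0::'a"] by (auto simp: I measure_def)
  ultimately show ?thesis
    using eq by (simp add: mult.commute[of _ ?I] ennreal_mult_cancel_left)
qed

section \<open>Orthogonality on the unit circle\<close>

lemma circle_mean_value:
  assumes h: "h holomorphic_on U" and U: "cball 0 1 \<subseteq> U"
  shows "((\<lambda>t. h (cis (2 * pi * t))) has_integral h 0) {0..1}"
proof -
  have "((\<lambda>u. h u / (u - 0)) has_contour_integral (2 * of_real pi * \<i> * h 0)) (circlepath 0 1)"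
    by (rule Cauchy_integral_circlepath_simple) (use holomorphic_on_subset[OF h U] in auto)
  then have "((\<lambda>t. (2 * of_real pi * \<i>) * h (cis (2 * pi * t))) has_integral (2 * of_real pi * \<i>) * h 0) {0..1}"
    unfolding has_contour_integral_def
    by (rule has_integral_eq[rotated])
       (simp only: vector_derivative_circlepath01 atLeastAtMost_iff, simp add: circlepath cis_conv_exp mult_ac)
  from has_integral_mult_right[OF this, of "1 / (2 * of_real pi * \<i>)"]
  show ?thesis by simp
qed

text \<open>In \<open>\<bar>a + h\<bar>\<^sup>2 = \<bar>a\<bar>\<^sup>2 + 2 Re (cnj a * h) + \<bar>h\<bar>\<^sup>2\<close> the mixed term integrates to \<open>0\<close> by the mean
  value property.\<close>
lemma circle_Pythagoras:
  assumes h: "h holomorphic_on U" and U: "cball 0 1 \<subseteq> U" and h0: "h 0 = 0"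
  shows "(\<integral>\<^sup>+t\<in>{0..1}. ennreal ((cmod (a + h (cis (2 * pi * t))))\<^sup>2) \<partial>lborel) =
    ennreal ((cmod a)\<^sup>2) + (\<integral>\<^sup>+t\<in>{0..1}. ennreal ((cmod (h (cis (2 * pi * t))))\<^sup>2) \<partial>lborel)"
proof -
  define u where "u t = h (cis (2 * pi * t))" for t
  have nn: "(\<integral>\<^sup>+t\<in>{0..1}. ennreal (v t) \<partial>lborel) = ennreal I"
    if "(v has_integral I) {0..1}" "\<And>t. 0 \<le> v t" for v :: "real \<Rightarrow> real" and I
    using nn_integral_has_integral_lebesgue[OF that(2,1)]
    by (simp add: indicator_mult_ennreal mult.commute[of _ "indicator _ _"])
  have cont: "continuous_on {0..1} u"
    unfolding u_def
    by (rule continuous_on_compose2[OF holomorphic_on_imp_continuous_on[OF h]])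
       (use U in \<open>auto intro!: continuous_intros\<close>)
  have "(u has_integral 0) {0..1}"
    using circle_mean_value[OF h U] by (simp add: u_def[abs_def] h0)
  from has_integral_Re[OF has_integral_mult_right[OF this, of "2 * cnj a"]]
  have cross: "((\<lambda>t. Re (2 * cnj a * u t)) has_integral 0) {0..1}"
    by simp
  define I where "I = integral {0..1} (\<lambda>t. (cmod (u t))\<^sup>2)"
  have I: "((\<lambda>t. (cmod (u t))\<^sup>2) has_integral I) {0..1}"
    unfolding I_def
    by (intro integrable_integral integrable_continuous_interval continuous_intros cont)
  have "0 \<le> I" using has_integral_nonneg[OF I] by simp
  have const: "((\<lambda>t::real. (cmod a)\<^sup>2) has_integral (cmod a)\<^sup>2) {0..1}"
    using has_integral_const_real[of "(cmod a)\<^sup>2" 0 1] by simp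
  have expand: "(cmod a)\<^sup>2 + Re (2 * cnj a * u t) + (cmod (u t))\<^sup>2 = (cmod (a + u t))\<^sup>2" for t
    unfolding cmod_power2 by (simp add: power2_eq_square algebra_simps)
  have "((\<lambda>t. (cmod (a + u t))\<^sup>2) has_integral (cmod a)\<^sup>2 + 0 + I) {0..1}"
    using has_integral_add[OF has_integral_add[OF const cross] I] by (simp only: expand)
  from nn[OF this] nn[OF I] \<open>0 \<le> I\<close> show ?thesis
    by (simp add: u_def)
qed

section \<open>Rotating the first coordinates\<close>

text \<open>The parameter \<open>c\<close> ranges over the closed unit disc: on the circle this is an isometry of the
  whole space, at \<open>c = 0\<close> it is the projection onto the slice, and the disc in between is where the
  mean value property is applied.\<close>
definition rotate_head :: "nat \<Rightarrow> complex \<Rightarrow> complex^'n::{finite,linorder} \<Rightarrow> complex^'n::_" where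
  "rotate_head k c z = c *s head_part k z + tail_part k z"

lemma rotate_head_nth:
  "rotate_head k c z $ i = (if i \<in> first_coords k then c * z $ i else z $ i)"
  by (simp add: rotate_head_def head_part_def tail_part_def)

lemma rotate_head_0: "rotate_head k 0 z = tail_part k z"
  by (simp add: vec_eq_iff rotate_head_nth tail_part_def)

lemma linear_rotate_head: "linear (rotate_head k c)"
  by (rule linearI) (auto simp: vec_eq_iff rotate_head_nth algebra_simps)

lemma norm_rotate_head_le: "cmod c \<le> 1 \<Longrightarrow> norm (rotate_head k c z) \<le> norm z"
  unfolding norm_vec_def
  by (rule L2_set_mono) (auto simp: rotate_head_nth norm_mult mult_left_le_one_le)

lemma norm_rotate_head: "cmod c = 1 \<Longrightarrow> norm (rotate_head k c z) = norm z"
  unfolding norm_vec_def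
  by (rule L2_set_cong) (auto simp: rotate_head_nth norm_mult)

lemma norm_head_part_rotate_head:
  "cmod c = 1 \<Longrightarrow> norm (head_part k (rotate_head k c z)) = norm (head_part k z)"
  unfolding norm_vec_def
  by (rule L2_set_cong) (auto simp: rotate_head_nth head_part_def norm_mult)

lemma tail_part_rotate_head: "tail_part k (rotate_head k c z) = tail_part k z"
  by (simp add: vec_eq_iff rotate_head_nth tail_part_def)

lemma continuous_rotate_head:
  "continuous_on UNIV (\<lambda>p::complex \<times> (complex^'n::{finite,linorder}). rotate_head k (fst p) (snd p))"
proof -
  have "continuous_on UNIV (\<lambda>p::complex \<times> (complex^'n::{finite,linorder}).
      if i \<in> first_coords k then fst p * snd p $ i else snd p $ i)" for i
    by (cases "i \<in> first_coords k") (auto intro!: continuous_intros)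
  then have "continuous_on UNIV (\<lambda>p::complex \<times> (complex^'n::{finite,linorder}).
      \<chi> i. if i \<in> first_coords k then fst p * snd p $ i else snd p $ i)"
    by (rule continuous_on_vec_lambda)
  moreover have "rotate_head k c z = (\<chi> i. if i \<in> first_coords k then c * z $ i else z $ i)"
    for c and z :: "complex^'n::{finite,linorder}"
    by (simp add: vec_eq_iff rotate_head_nth)
  ultimately show ?thesis by simp
qed

lemma linear_tail_part: "linear (tail_part k)"
  by (rule linearI) (auto simp: vec_eq_iff tail_part_def)

lemma tail_part_in_slice: "z \<in> unit_ball \<Longrightarrow> tail_part k z \<in> linear_slice k"
  using norm_rotate_head_le[of 0 k z]
  by (auto simp: linear_slice_def rotate_head_0 vec_eq_iff head_part_def tail_part_def)

lemma tail_part_slice: "z \<in> linear_slice k \<Longrightarrow> tail_part k z = z"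
  by (auto simp: linear_slice_def vec_eq_iff head_part_def tail_part_def split: if_splits)

section \<open>Holomorphic functions of several variables\<close>

lemma sev_holomorphic_on_imp_continuous_on:
  "sev_holomorphic_on f S \<Longrightarrow> continuous_on S f"
  unfolding sev_holomorphic_on_def
  by (meson continuous_on_eq_continuous_within has_derivative_continuous)

text \<open>A derivative of \<open>f\<close> within the slice is enough for the chain rule, because the projection maps
  the ball into the slice; the arbitrary transversal values of that derivative are cut off by the
  projection.\<close>
lemma sev_holomorphic_on_compose_tail:
  fixes f :: "complex^'n::{finite,linorder} \<Rightarrow> complex"
  assumes "sev_holomorphic_on f (linear_slice k)"
  shows "sev_holomorphic_on (\<lambda>z. f (tail_part k z)) unit_ball"
  unfolding sev_holomorphic_on_def
proof
  fix z :: "complex^'n::_" assume z: "z \<in> unit_ball"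
  obtain D where D: "Vector_Spaces.linear (*s) (*) D"
    and der: "(f has_derivative D) (at (tail_part k z) within linear_slice k)"
    using assms tail_part_in_slice[OF z] unfolding sev_holomorphic_on_def by blast
  have "(tail_part k has_derivative tail_part k) (at z within unit_ball)"
    by (intro bounded_linear_imp_has_derivative linear_conv_bounded_linear[THEN iffD1] linear_tail_part)
  moreover have "(f has_derivative D) (at (tail_part k z) within tail_part k ` unit_ball)"
    by (rule has_derivative_subset[OF der]) (use tail_part_in_slice in blast)
  ultimately have "(f \<circ> tail_part k has_derivative D \<circ> tail_part k) (at z within unit_ball)"
    by (rule diff_chain_within)
  moreover have "Vector_Spaces.linear (*s) (*s) (tail_part k :: complex^'n::_ \<Rightarrow> _)"
    by unfold_locales (auto simp: vec_eq_iff tail_part_def algebra_simps)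
  then have "Vector_Spaces.linear (*s) (*) (D \<circ> tail_part k)"
    using D by (rule Vector_Spaces.linear_compose)
  ultimately show "\<exists>D. Vector_Spaces.linear (*s) (*) D \<and>
      ((\<lambda>z. f (tail_part k z)) has_derivative D) (at z within unit_ball)"
    by (auto simp: o_def)
qed

lemma holomorphic_on_rotate_head:
  assumes G: "sev_holomorphic_on G unit_ball"
  shows "(\<lambda>\<zeta>. G (rotate_head k \<zeta> z)) holomorphic_on {\<zeta>. rotate_head k \<zeta> z \<in> unit_ball}"
  unfolding holomorphic_on_def field_differentiable_def
proof
  fix \<zeta> assume "\<zeta> \<in> {\<zeta>. rotate_head k \<zeta> z \<in> unit_ball}"
  then obtain D where D: "Vector_Spaces.linear (*s) (*) D"
    and der: "(G has_derivative D) (at (rotate_head k \<zeta> z) within unit_ball)"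
    using G unfolding sev_holomorphic_on_def by blast
  interpret D: Vector_Spaces.linear "(*s)" "(*)" D by fact
  let ?S = "{\<zeta>. rotate_head k \<zeta> z \<in> unit_ball}"
  have "((\<lambda>\<zeta>. rotate_head k \<zeta> z) has_derivative (\<lambda>h. h *s head_part k z)) (at \<zeta> within ?S)"
  proof -
    have "linear (\<lambda>h. h *s head_part k z)"
      by (rule linearI) (auto simp: vec_eq_iff algebra_simps)
    then have "((\<lambda>h. h *s head_part k z) has_derivative (\<lambda>h. h *s head_part k z)) (at \<zeta> within ?S)"
      by (simp add: linear_conv_bounded_linear bounded_linear_imp_has_derivative)
    from has_derivative_add[OF this has_derivative_const] show ?thesis
      by (simp add: rotate_head_def)
  qed
  moreover have "(G has_derivative D) (at (rotate_head k \<zeta> z) within (\<lambda>\<zeta>. rotate_head k \<zeta> z) ` ?S)"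
    by (rule has_derivative_subset[OF der]) auto
  ultimately have "((\<lambda>\<zeta>. G (rotate_head k \<zeta> z)) has_derivative (\<lambda>h. D (h *s head_part k z))) (at \<zeta> within ?S)"
    using diff_chain_within by (fastforce simp: o_def)
  then show "\<exists>f'. ((\<lambda>\<zeta>. G (rotate_head k \<zeta> z)) has_field_derivative f') (at \<zeta> within ?S)"
    unfolding has_field_derivative_def by (auto simp: D.scale mult.commute[of _ "D _"])
qed

section \<open>The weight\<close>

lemma borel_measurable_exp_uminus [measurable]: "exp_uminus \<in> borel_measurable borel"
proof -
  have "exp_uminus = (\<lambda>x. if x = \<infinity> then 0 else if x = -\<infinity> then \<infinity> else ennreal (exp (- real_of_ereal x)))"
    by (auto simp: exp_uminus_def fun_eq_iff split: ereal.split)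
  moreover have "(\<lambda>x::ereal. if x = \<infinity> then 0 else if x = -\<infinity> then \<infinity> else ennreal (exp (- real_of_ereal x)))
      \<in> borel_measurable borel"
    by measurable
  ultimately show ?thesis by simp
qed

lemma borel_measurable_weight:
  assumes "plurisubharmonic_on \<phi> S"
  shows "(\<lambda>z. exp_uminus (\<phi> z) * indicator S z) \<in> borel_measurable borel"
proof -
  \<comment> \<open>The value \<open>\<infinity>\<close> outside \<open>S\<close> makes the weight vanish there and keeps the strict sublevel sets
    inside \<open>S\<close>, where they are open.\<close>
  define \<phi>' where "\<phi>' z = (if z \<in> S then \<phi> z else \<infinity>)" for z
  have S: "open S" and usc: "\<And>a. openin (top_of_set S) {z \<in> S. \<phi> z < a}"
    using assms by (auto simp: plurisubharmonic_on_def)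
  have [measurable]: "\<phi>' \<in> borel_measurable borel"
  proof (rule borel_measurableI_less)
    fix a
    have "{z \<in> space borel. \<phi>' z < a} = {z \<in> S. \<phi> z < a}"
      by (auto simp: \<phi>'_def)
    moreover have "open {z \<in> S. \<phi> z < a}"
      using usc[of a] S openin_open_eq by blast
    ultimately show "{z \<in> space borel. \<phi>' z < a} \<in> sets borel"
      by simp
  qed
  have "(\<lambda>z. exp_uminus (\<phi> z) * indicator S z) = (\<lambda>z. exp_uminus (\<phi>' z))"
    by (auto simp: \<phi>'_def exp_uminus_def indicator_def)
  then show ?thesis by simp
qed

lemma AE_open_continuous_imp_zero:
  fixes h :: "'a::euclidean_space \<Rightarrow> 'b::real_normed_vector"
  assumes "open S" "continuous_on S h" "AE z in lborel. z \<in> S \<longrightarrow> h z = 0" "z \<in> S"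
  shows "h z = 0"
proof (rule ccontr)
  assume "h z \<noteq> 0"
  define A where "A = {z \<in> S. h z \<noteq> 0}"
  have "A = S \<inter> h -` (- {0})" by (auto simp: A_def)
  then have "open A"
    using continuous_open_preimage[OF assms(2,1), of "- {0}"] by (simp add: open_Compl)
  then obtain e where e: "e > 0" "ball z e \<subseteq> A"
    using \<open>h z \<noteq> 0\<close> \<open>z \<in> S\<close> by (auto simp: A_def open_contains_ball)
  have "AE z in lborel. z \<notin> A"
    using assms(3) by (auto simp: A_def)
  then have "emeasure lborel A = 0"
    using \<open>open A\<close> by (subst (asm) AE_iff_measurable[where N=A]) auto
  then have "emeasure lborel (ball z e) = 0"
    using e \<open>open A\<close> by (metis emeasure_mono le_zero_eq sets_lborel borel_open)
  then show False
    using content_ball_pos[OF e(1), of z] by (simp add: measure_def)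
qed

section \<open>Averaging over the rotations\<close>

text \<open>For each single \<open>t\<close> the rotation leaves the weighted norm unchanged; the norm is thus its own
  mean over \<open>t \<in> [0, 1]\<close>, and Tonelli moves this mean inside.  The weight, being constant on the
  circles, stays outside of it.\<close>
lemma rotation_average:
  fixes \<phi> :: "complex^'n::{finite,linorder} \<Rightarrow> ereal"
  assumes psh: "plurisubharmonic_on \<phi> unit_ball" and rad: "radial_wrt_slice k \<phi>"
    and K: "continuous_on unit_ball K"
  defines "avg \<equiv> \<lambda>z. \<integral>\<^sup>+t\<in>{0..1}. ennreal ((cmod (K (rotate_head k (cis (2 * pi * t)) z)))\<^sup>2) \<partial>lborel"
  shows "weighted_sq_norm \<phi> K = (\<integral>\<^sup>+z. avg z * (exp_uminus (\<phi> z) * indicator unit_ball z) \<partial>lborel)"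
    and "(\<lambda>z. avg z * (exp_uminus (\<phi> z) * indicator unit_ball z)) \<in> borel_measurable borel"
proof -
  define w where "w z = exp_uminus (\<phi> z) * indicator unit_ball z" for z
  \<comment> \<open>Nothing is known about \<open>K\<close> outside the ball, not even measurability.\<close>
  define K' where "K' z = (if z \<in> unit_ball then K z else 0)" for z
  define R where "R t z = rotate_head k (cis (2 * pi * t)) z" for t :: real and z :: "complex^'n::_"
  have w [measurable]: "w \<in> borel_measurable borel"
    unfolding w_def by (rule borel_measurable_weight[OF psh])
  have K' [measurable]: "K' \<in> borel_measurable borel"
    unfolding K'_def by (rule borel_measurable_continuous_on_if) (auto intro: K)
  have "continuous_on UNIV (\<lambda>p::real \<times> (complex^'n::_). R (fst p) (snd p))"
    unfolding R_def
    by (rule continuous_on_compose2[OF continuous_rotate_head, of _ "\<lambda>p. (cis (2 * pi * fst p), snd p)", simplified])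
       (auto intro!: continuous_intros)
  then have "(\<lambda>p::real \<times> (complex^'n::_). R (fst p) (snd p)) \<in> borel_measurable borel"
    by (rule borel_measurable_continuous_onI)
  then have R2: "(\<lambda>p::real \<times> (complex^'n::_). R (fst p) (snd p)) \<in> borel \<Otimes>\<^sub>M borel \<rightarrow>\<^sub>M borel"
    by (simp add: borel_prod)
  have R2' [measurable]: "(\<lambda>x. R (a x) (b x)) \<in> N \<rightarrow>\<^sub>M borel"
    if [measurable]: "a \<in> borel_measurable N" "b \<in> borel_measurable N" for a b and N :: "'z measure"
    using measurable_compose[OF _ R2, of "\<lambda>x. (a x, b x)" N] by simp
  have ball_R: "R t z \<in> unit_ball \<longleftrightarrow> z \<in> unit_ball" for t z
    by (simp add: R_def norm_rotate_head)
  have w_R: "w (R t z) = w z" for t z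
  proof (cases "z \<in> unit_ball")
    case True
    obtain \<psi> where "\<forall>z\<in>unit_ball. \<phi> z = \<psi> (norm (head_part k z))"
      using rad unfolding radial_wrt_slice_def by blast
    with True ball_R[of t z] have "\<phi> (R t z) = \<phi> z"
      by (simp add: R_def norm_head_part_rotate_head)
    with ball_R[of t z] show ?thesis by (simp add: w_def indicator_def)
  qed (use ball_R[of t z] in \<open>simp add: w_def\<close>)
  have avg_w: "avg z * w z = (\<integral>\<^sup>+t\<in>{0..1}. ennreal ((cmod (K' (R t z)))\<^sup>2) * w z \<partial>lborel)" for z
  proof (cases "z \<in> unit_ball")
    case True
    then have "avg z = (\<integral>\<^sup>+t\<in>{0..1}. ennreal ((cmod (K' (R t z)))\<^sup>2) \<partial>lborel)"
      using ball_R[of _ z] by (simp add: avg_def K'_def R_def)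
    then show ?thesis
      by (simp add: nn_integral_cmult[symmetric] mult_ac)
  qed (simp add: w_def)
  show "(\<lambda>z. avg z * (exp_uminus (\<phi> z) * indicator unit_ball z)) \<in> borel_measurable borel"
    unfolding w_def[symmetric] avg_w by measurable
  have "weighted_sq_norm \<phi> K = (\<integral>\<^sup>+z. ennreal ((cmod (K' z))\<^sup>2) * w z \<partial>lborel)"
    unfolding weighted_sq_norm_def
    by (rule nn_integral_cong) (simp add: w_def K'_def indicator_def)
  also have "\<dots> = (\<integral>\<^sup>+t\<in>{0..1::real}. (\<integral>\<^sup>+z. ennreal ((cmod (K' z))\<^sup>2) * w z \<partial>lborel) \<partial>lborel)"
    by (simp add: nn_integral_cmult)
  also have "\<dots> = (\<integral>\<^sup>+t\<in>{0..1::real}. (\<integral>\<^sup>+z. ennreal ((cmod (K' (R t z)))\<^sup>2) * w (R t z) \<partial>lborel) \<partial>lborel)"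
    unfolding R_def
    by (subst nn_integral_lborel_linear_isometry[OF linear_rotate_head norm_rotate_head]) simp_all
  also have "\<dots> = (\<integral>\<^sup>+t. (\<integral>\<^sup>+z. ennreal ((cmod (K' (R t z)))\<^sup>2) * w z * indicator {0..1} t \<partial>lborel) \<partial>lborel)"
    by (simp add: w_R nn_integral_multc)
  also have "\<dots> = (\<integral>\<^sup>+z. (\<integral>\<^sup>+t. ennreal ((cmod (K' (R t z)))\<^sup>2) * w z * indicator {0..1} t \<partial>lborel) \<partial>lborel)"
    by (rule lborel_pair.Fubini'[symmetric]) measurable
  finally show "weighted_sq_norm \<phi> K = (\<integral>\<^sup>+z. avg z * (exp_uminus (\<phi> z) * indicator unit_ball z) \<partial>lborel)"
    unfolding w_def[symmetric] avg_w .
qed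

section \<open>Minimality and uniqueness\<close>

lemma weighted_sq_norm_Pythagoras:
  fixes \<phi> :: "complex^'n::{finite,linorder} \<Rightarrow> ereal"
  assumes psh: "plurisubharmonic_on \<phi> unit_ball" and rad: "radial_wrt_slice k \<phi>"
    and G: "sev_holomorphic_on G unit_ball"
  shows "weighted_sq_norm \<phi> G =
    weighted_sq_norm \<phi> (\<lambda>z. G (tail_part k z)) + weighted_sq_norm \<phi> (\<lambda>z. G z - G (tail_part k z))"
proof -
  define F where "F z = G (tail_part k z)" for z
  define H where "H z = G z - F z" for z
  define w where "w z = exp_uminus (\<phi> z) * indicator unit_ball z" for z
  define avg where "avg K z = (\<integral>\<^sup>+t\<in>{0..1}. ennreal ((cmod (K (rotate_head k (cis (2 * pi * t)) z)))\<^sup>2) \<partial>lborel)"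
    for K :: "complex^'n::_ \<Rightarrow> complex" and z
  have ball_rot: "rotate_head k \<zeta> z \<in> unit_ball" if "z \<in> unit_ball" "cmod \<zeta> \<le> 1" for \<zeta> z
    using norm_rotate_head_le[OF that(2), of k z] that(1) by simp
  have contG: "continuous_on unit_ball G"
    by (rule sev_holomorphic_on_imp_continuous_on[OF G])
  have contF: "continuous_on unit_ball F"
    unfolding F_def
    by (rule continuous_on_compose2[OF contG])
       (use ball_rot[of _ 0] in \<open>auto simp: rotate_head_0
          intro!: linear_continuous_on linear_conv_bounded_linear[THEN iffD1] linear_tail_part\<close>)
  have contH: "continuous_on unit_ball H"
    unfolding H_def by (intro continuous_intros contF contG)
  have avg_G: "avg G z = avg F z + avg H z" if z: "z \<in> unit_ball" for z
  proof -
    have rot: "G (rotate_head k c z) = F z + H (rotate_head k c z)"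
              "F (rotate_head k c z) = F z" for c
      by (simp_all add: F_def H_def tail_part_rotate_head)
    have hol: "(\<lambda>\<zeta>. H (rotate_head k \<zeta> z)) holomorphic_on {\<zeta>. rotate_head k \<zeta> z \<in> unit_ball}"
      unfolding H_def rot(2) by (intro holomorphic_intros holomorphic_on_rotate_head G)
    have "cball 0 1 \<subseteq> {\<zeta>. rotate_head k \<zeta> z \<in> unit_ball}"
      using ball_rot[OF z] by auto
    moreover have "H (rotate_head k 0 z) = 0"
      using rot(1)[of 0] by (simp add: F_def rotate_head_0)
    ultimately show ?thesis
      unfolding avg_def rot using circle_Pythagoras[OF hol, of "F z"]
      by (simp add: nn_integral_cmult)
  qed
  have avg: "weighted_sq_norm \<phi> K = (\<integral>\<^sup>+z. avg K z * w z \<partial>lborel)"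
    "(\<lambda>z. avg K z * w z) \<in> borel_measurable borel" if "continuous_on unit_ball K" for K
    using rotation_average[OF psh rad that] unfolding avg_def w_def by auto
  have "weighted_sq_norm \<phi> G = (\<integral>\<^sup>+z. avg F z * w z + avg H z * w z \<partial>lborel)"
    unfolding avg(1)[OF contG]
    by (rule nn_integral_cong) (auto simp: avg_G w_def indicator_def distrib_right)
  also have "\<dots> = weighted_sq_norm \<phi> F + weighted_sq_norm \<phi> H"
    using avg(2)[OF contF] avg(2)[OF contH]
    by (simp add: avg(1)[OF contF] avg(1)[OF contH] nn_integral_add)
  finally show ?thesis unfolding F_def[abs_def] H_def[abs_def] .
qed

lemma weighted_sq_norm_eq_0_imp:
  fixes \<phi> :: "complex^'n::finite \<Rightarrow> ereal"
  assumes psh: "plurisubharmonic_on \<phi> unit_ball" and H: "continuous_on unit_ball H"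
    and "weighted_sq_norm \<phi> H = 0" and z: "z \<in> unit_ball"
  shows "H z = 0"
proof (rule AE_open_continuous_imp_zero[OF open_ball H _ z])
  define w where "w z = exp_uminus (\<phi> z) * indicator unit_ball z" for z
  define H' where "H' z = (if z \<in> unit_ball then H z else 0)" for z
  have [measurable]: "w \<in> borel_measurable borel"
    unfolding w_def by (rule borel_measurable_weight[OF psh])
  have [measurable]: "H' \<in> borel_measurable borel"
    unfolding H'_def by (rule borel_measurable_continuous_on_if) (auto intro: H)
  have "weighted_sq_norm \<phi> H = (\<integral>\<^sup>+z. ennreal ((cmod (H' z))\<^sup>2) * w z \<partial>lborel)"
    unfolding weighted_sq_norm_def
    by (rule nn_integral_cong) (simp add: w_def H'_def indicator_def)
  with assms have "AE z in lborel. ennreal ((cmod (H' z))\<^sup>2) * w z = 0"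
    by (simp add: nn_integral_0_iff_AE)
  moreover have "w z \<noteq> 0" if "z \<in> unit_ball" for z
  proof -
    \<comment> \<open>At points with \<open>\<phi> z = -\<infinity>\<close> the weight is \<open>\<infinity>\<close>, which is also nonzero.\<close>
    have "\<phi> z < \<infinity>" using psh that by (simp add: plurisubharmonic_on_def)
    with that show ?thesis
      by (cases "\<phi> z") (auto simp: w_def exp_uminus_def)
  qed
  ultimately show "AE z in lborel. z \<in> unit_ball \<longrightarrow> H z = 0"
    by (auto simp: H'_def elim!: eventually_mono)
qed

theorem mainTheorem4:
  fixes k :: nat
    and \<phi> :: "complex^'n::{finite,linorder} \<Rightarrow> ereal"
    and f :: "complex^'n::_ \<Rightarrow> complex"
  assumes "k \<le> CARD('n)"
    and "plurisubharmonic_on \<phi> unit_ball"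
    and "radial_wrt_slice k \<phi>"
    and "sev_holomorphic_on f (linear_slice k)"
  shows "L2_minimum_extension k \<phi> f (\<lambda>z. f (tail_part k z)) \<and>
         (\<forall>G. L2_minimum_extension k \<phi> f G \<and> weighted_sq_norm \<phi> G < \<infinity> \<longrightarrow>
              (\<forall>z\<in>unit_ball. G z = f (tail_part k z)))"
proof -
  let ?F = "\<lambda>z. f (tail_part k z)"
  have F: "holomorphic_extension k f ?F"
    using sev_holomorphic_on_compose_tail[OF assms(4)]
    by (simp add: holomorphic_extension_def tail_part_slice)
  \<comment> \<open>On the ball every extension \<open>G\<close> satisfies \<open>G (0, z'') = f (0, z'')\<close>; outside the ball the two
    functions may differ, but the weighted norm does not see this.\<close>
  have split: "weighted_sq_norm \<phi> G = weighted_sq_norm \<phi> ?F + weighted_sq_norm \<phi> (\<lambda>z. G z - ?F z)"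
    if G: "holomorphic_extension k f G" for G
  proof -
    have "G (tail_part k z) = ?F z" if "z \<in> unit_ball" for z
      using G tail_part_in_slice[OF that] by (simp add: holomorphic_extension_def)
    then have "weighted_sq_norm \<phi> (\<lambda>z. G (tail_part k z)) = weighted_sq_norm \<phi> ?F"
      "weighted_sq_norm \<phi> (\<lambda>z. G z - G (tail_part k z)) = weighted_sq_norm \<phi> (\<lambda>z. G z - ?F z)"
      unfolding weighted_sq_norm_def by (auto intro!: nn_integral_cong simp: indicator_def)
    with weighted_sq_norm_Pythagoras[OF assms(2,3), of G] G show ?thesis
      by (simp add: holomorphic_extension_def)
  qed
  have min: "L2_minimum_extension k \<phi> f ?F"
    unfolding L2_minimum_extension_def
  proof (intro conjI allI impI F)
    fix G assume "holomorphic_extension k f G"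
    from split[OF this] show "weighted_sq_norm \<phi> ?F \<le> weighted_sq_norm \<phi> G"
      by simp
  qed
  moreover have "G z = ?F z"
    if G: "L2_minimum_extension k \<phi> f G" and fin: "weighted_sq_norm \<phi> G < \<infinity>" and z: "z \<in> unit_ball"
    for G z
  proof -
    have ext: "holomorphic_extension k f G" and "weighted_sq_norm \<phi> G \<le> weighted_sq_norm \<phi> ?F"
      using G F by (auto simp: L2_minimum_extension_def)
    with split[OF ext] have
      "weighted_sq_norm \<phi> ?F + weighted_sq_norm \<phi> (\<lambda>z. G z - ?F z) \<le> weighted_sq_norm \<phi> ?F + 0"
      by simp
    moreover have "weighted_sq_norm \<phi> ?F \<noteq> top"
      using split[OF ext] fin by auto
    ultimately have "weighted_sq_norm \<phi> (\<lambda>z. G z - ?F z) = 0"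
      unfolding ennreal_add_left_cancel_le by simp
    moreover have "continuous_on unit_ball (\<lambda>z. G z - ?F z)"
      using ext F unfolding holomorphic_extension_def
      by (intro continuous_on_diff sev_holomorphic_on_imp_continuous_on) blast+
    ultimately show ?thesis
      using weighted_sq_norm_eq_0_imp[OF assms(2) _ _ z, of "\<lambda>z. G z - ?F z"] by simp
  qed
  ultimately show ?thesis by blast
qed

end
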